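(* Let $d\geq 3$ be an integer and let $p(d)$ be the probability that the simple symmetric random walk on $\mathbb{Z}^d$ started at the origin returns to the origin. Then $$p(d)=1-\left[F_C^{(d)}\left(1,\tfrac12;1,\ldots,1;\tfrac{1}{d^2},\ldots,\tfrac{1}{d^2}\right)\right]^{-1},$$ where both the parameter $1$ (after the first semicolon) and the argument $\tfrac1{d^2}$ are repeated $d$ times.
   Context: The simple symmetric random walk on $\mathbb{Z}^d$ moves at each step, independently of the past, from its current site to one of the $2d$ nearest neighbours, each with probability $\frac{1}{2d}$. The return probability $p(d)$ is the probability that the walk visits the origin at some time $n\geq 1$. The Lauricella function $F_C^{(d)}$ of $d$ variables is defined by the series $$F_C^{(d)}(a,b;c_1,\ldots,c_d;x_1,\ldots,x_d)=\sum_{k_1\geq 0}\cdots\sum_{k_d\geq 0}\frac{(a)_{k_1+\cdots+k_d}\,(b)_{k_1+\cdots+k_d}}{(c_1)_{k_1}\cdots(c_d)_{k_d}}\,\frac{x_1^{k_1}\cdots x_d^{k_d}}{k_1!\cdots k_d!},$$ where $(f)_k=f(f+1)\cdots(f+k-1)$, with $(f)_0=1$, is the Pochhammer symbol (ascending factorial). *)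

theory Defs
  imports "HOL-Probability.Probability"
begin

definition unit_steps :: "(int ^ 'd) set" where
  "unit_steps = {axis i s | i s. s = 1 \<or> s = -1}"

text \<open>
  The walk on $\mathbb{Z}^d$, $d$ = \<open>CARD('d)\<close>, started at the origin, as a process \<open>S\<close> on an
  arbitrary probability space \<open>M\<close>: its increments are independent and each of the $2d$ unit
  steps has probability $1/(2d)$.
\<close>

definition simple_random_walk :: "'a measure \<Rightarrow> (nat \<Rightarrow> 'a \<Rightarrow> int ^ 'd) \<Rightarrow> bool" where
  "simple_random_walk M S \<longleftrightarrow>
     prob_space M \<and>
     (\<forall>\<omega>\<in>space M. S 0 \<omega> = 0) \<and>
     prob_space.indep_vars M (\<lambda>_. count_space UNIV) (\<lambda>n \<omega>. S (Suc n) \<omega> - S n \<omega>) UNIV \<and>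
     (\<forall>n. \<forall>u\<in>unit_steps.
        measure M {\<omega>\<in>space M. S (Suc n) \<omega> - S n \<omega> = u} = 1 / (2 * real CARD('d)))"

lemma card_unit_steps: "card (unit_steps :: (int ^ 'd) set) = 2 * CARD('d)"
proof -
  have eq: "(unit_steps :: (int ^ 'd) set) = (\<lambda>(i, s). axis i s) ` (UNIV \<times> {1, -1})"
    unfolding unit_steps_def by auto
  have "inj_on (\<lambda>(i, s). axis i s :: int ^ 'd) (UNIV \<times> {1, -1})"
    by (auto simp: inj_on_def axis_eq_axis)
  then show ?thesis
    unfolding eq by (subst card_image) (auto simp: card_cartesian_product)
qed

text \<open>Such a process exists: partial sums of the coordinates of an infinite product space.\<close>

lemma ex_simple_random_walk:
  "\<exists>(M :: (nat \<Rightarrow> int ^ 'd) measure) S :: nat \<Rightarrow> (nat \<Rightarrow> int ^ 'd) \<Rightarrow> int ^ 'd. simple_random_walk M S"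
proof -
  define p :: "(int ^ 'd) pmf" where "p = pmf_of_set unit_steps"
  define M where "M = (\<Pi>\<^sub>M (_::nat)\<in>UNIV. measure_pmf p)"
  define S :: "nat \<Rightarrow> (nat \<Rightarrow> int ^ 'd) \<Rightarrow> int ^ 'd" where "S = (\<lambda>n \<omega>. \<Sum>i<n. \<omega> i)"
  have card: "card (unit_steps :: (int ^ 'd) set) = 2 * CARD('d)"
    by (rule card_unit_steps)
  then have fin: "finite (unit_steps :: (int ^ 'd) set)" and ne: "(unit_steps :: (int ^ 'd) set) \<noteq> {}"
    by (auto intro: card_ge_0_finite)
  interpret prob_space M
    unfolding M_def by (intro prob_space_PiM measure_pmf.prob_space_axioms)
  have sp: "space M = UNIV"
    by (auto simp: M_def space_PiM)
  have incr: "S (Suc n) \<omega> - S n \<omega> = \<omega> n" for n \<omega>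
    by (simp add: S_def)
  have rv: "(\<lambda>\<omega>. \<omega> n) \<in> M \<rightarrow>\<^sub>M count_space UNIV" for n
    using measurable_component_singleton[of n UNIV "\<lambda>_. measure_pmf p"]
    unfolding M_def by (simp cong: measurable_cong_sets)
  have distr: "distr M (count_space UNIV) (\<lambda>\<omega>. \<omega> n) = measure_pmf p" for n
  proof -
    have "distr M (measure_pmf p) (\<lambda>\<omega>. \<omega> n) = measure_pmf p"
      unfolding M_def by (intro distr_PiM_component measure_pmf.prob_space_axioms) simp
    moreover have "distr M (count_space UNIV) (\<lambda>\<omega>. \<omega> n) = distr M (measure_pmf p) (\<lambda>\<omega>. \<omega> n)"
      by (rule distr_cong) simp_all
    ultimately show ?thesis
      by simp
  qed
  have "indep_vars (\<lambda>_. count_space UNIV) (\<lambda>n \<omega>. \<omega> n) (UNIV :: nat set)"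
  proof (subst indep_vars_iff_distr_eq_PiM)
    have "distr M (\<Pi>\<^sub>M (_::nat)\<in>UNIV. count_space UNIV) (\<lambda>\<omega>. \<lambda>n\<in>UNIV. \<omega> n) = distr M M (\<lambda>\<omega>. \<omega>)"
      unfolding M_def by (intro distr_cong sets_PiM_cong) auto
    also have "\<dots> = (\<Pi>\<^sub>M (_::nat)\<in>UNIV. measure_pmf p)"
      by (simp add: M_def)
    finally show "distr M (\<Pi>\<^sub>M (_::nat)\<in>UNIV. count_space UNIV) (\<lambda>\<omega>. \<lambda>n\<in>UNIV. \<omega> n) =
        (\<Pi>\<^sub>M n\<in>UNIV. distr M (count_space UNIV) (\<lambda>\<omega>. \<omega> n))"
      by (simp only: distr)
  qed (use rv in auto)
  moreover have "measure M {\<omega>\<in>space M. \<omega> n = u} = 1 / (2 * real CARD('d))" if "u \<in> unit_steps" for n u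
  proof -
    have "measure M {\<omega>\<in>space M. \<omega> n = u} = measure (distr M (count_space UNIV) (\<lambda>\<omega>. \<omega> n)) {u}"
      by (subst measure_distr[OF rv]) (auto intro!: arg_cong[where f = "measure M"])
    also have "\<dots> = 1 / (2 * real CARD('d))"
      using that fin ne card by (simp add: distr p_def measure_pmf_single)
    finally show ?thesis .
  qed
  ultimately have "simple_random_walk M S"
    unfolding simple_random_walk_def incr using prob_space_axioms by (auto simp: S_def)
  then show ?thesis
    by blast
qed

definition return_probability :: "'a measure \<Rightarrow> (nat \<Rightarrow> 'a \<Rightarrow> int ^ 'd) \<Rightarrow> real" where
  "return_probability M S = measure M {\<omega>\<in>space M. \<exists>n\<ge>1. S n \<omega> = 0}"

definition lauricella_FC_term ::
  "'a::real_normed_field \<Rightarrow> 'a \<Rightarrow> 'a ^ 'd \<Rightarrow> 'a ^ 'd \<Rightarrow> nat ^ 'd \<Rightarrow> 'a" where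
  "lauricella_FC_term a b c x k =
     pochhammer a (\<Sum>i\<in>UNIV. k $ i) * pochhammer b (\<Sum>i\<in>UNIV. k $ i)
       / (\<Prod>i\<in>UNIV. pochhammer (c $ i) (k $ i))
     * ((\<Prod>i\<in>UNIV. (x $ i) ^ (k $ i)) / (\<Prod>i\<in>UNIV. fact (k $ i)))"

text \<open>
  The multiple series is read as the unconditional sum over all multi-indices. As \<open>infsum\<close>
  returns 0 for a family that is not summable, a statement about a value of \<open>lauricella_FC\<close>
  should be accompanied by a statement that the family of terms is summable.
\<close>

definition lauricella_FC ::
  "'a::real_normed_field \<Rightarrow> 'a \<Rightarrow> 'a ^ 'd \<Rightarrow> 'a ^ 'd \<Rightarrow> 'a" where
  "lauricella_FC a b c x = (\<Sum>\<^sub>\<infinity>k. lauricella_FC_term a b c x k)"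

end

theory Submission
  imports Defs "HOL-Combinatorics.Multiset_Permutations"
begin

text \<open>
  Write $d$ for \<open>CARD('d)\<close>, let $u_n$ be the probability that the walk is at the origin at time $n$,
  and $f_n$ the probability that it returns there for the first time at time $n \ge 1$. The return
  probability is $p = \sum f_n$. Cutting a closed walk at its first return gives the renewal equation
  $u_n = \sum_k f_k u_{n-k}$ for $n \ge 1$, and $u_0 = 1$; hence, when $G = \sum u_n$ is finite,
  multiplying the two series gives $p G = G - 1$, that is, $p = 1 - 1/G$. All walks of length $n$ in
  the $2d$ unit steps have the same probability, so the renewal equation is an identity between
  cardinalities of sets of walks (\<open>card_loops_renewal\<close>); probability enters only in
  \<open>prob_increments_in\<close> and \<open>return_probability_sums\<close>.

  It remains to identify $G$ with the Lauricella series. A closed walk makes, in each direction $i$,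
  as many steps forwards as backwards, say $k_i$ of each. With $|k| = n$ the number of such walks is the
  multinomial coefficient $(2n)! / \prod_i k_i!^2$. Dividing by $(2d)^{2n}$ and using
  $(1)_n (1/2)_n = (2n)!/4^n$ turns this number into the term of the Lauricella series with index $k$
  (\<open>lauricella_FC_term_eq_loop_weight\<close>, \<open>card_loops_eq_sum\<close>).

  Finiteness of $G$ is the transience of the walk for $d \ge 3$. Replacing $(2n)!$ by
  $\int_0^\infty e^{-t} t^{2n}\,dt$ makes the term with index $k$ the integral of a product over the
  directions, so that a sum over a box of indices is
  $\int_0^\infty e^{-t} B(t/d)^d\,dt$ with $B$ a partial sum of the modified Bessel function $I_0$.
  Because $e^{-s} B(s) \le \min(1, 1/(2\sqrt s))$, the integrand is at most
  $\min(1, (t/d)^{-3/2})$, whose integral is $3d$ (\<open>loop_weight_box_le\<close>).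
\<close>

section \<open>Bounds for partial sums of the Bessel series\<close>

text \<open>
  The central binomial coefficient satisfies $\binom{2k}{k} \le 4^k / \sqrt{2k+1}$. This is stated
  squared and with the denominators cleared so that it follows by induction from
  $(2k+1)(2k+3) \le (2k+2)^2$.
\<close>

lemma central_binomial_square_le:
  "(2 * real k + 1) * (fact (2 * k))\<^sup>2 \<le> (4 ^ k * (fact k)\<^sup>2)\<^sup>2"
proof (induction k)
  case 0
  show ?case by simp
next
  case (Suc k)
  define a where "a = (2 * real k + 1) * (fact (2 * k))\<^sup>2"
  define b :: real where "b = (4 ^ k * (fact k)\<^sup>2)\<^sup>2"
  have "(2 * real (Suc k) + 1) * (fact (2 * Suc k))\<^sup>2 =
        (2 * real k + 3) * (2 * real k + 1) * (2 * real k + 2)\<^sup>2 * a"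
    by (simp add: a_def power2_eq_square algebra_simps)
  also have "\<dots> \<le> (2 * real k + 2)\<^sup>2 * (2 * real k + 2)\<^sup>2 * b"
  proof (rule mult_mono)
    show "(2 * real k + 3) * (2 * real k + 1) * (2 * real k + 2)\<^sup>2
        \<le> (2 * real k + 2)\<^sup>2 * (2 * real k + 2)\<^sup>2"
      by (rule mult_right_mono) (auto simp: power2_eq_square algebra_simps)
    show "a \<le> b" using Suc by (simp add: a_def b_def)
  qed (auto simp: a_def)
  also have "\<dots> = (4 ^ Suc k * (fact (Suc k))\<^sup>2)\<^sup>2"
    by (simp add: b_def power2_eq_square algebra_simps)
  finally show ?case .
qed

text \<open>
  With $x = \binom{2k}{k} / 4^k$ the inequality $2 \sqrt s\, x \le s x^2 + 1 \le s/(2k+1) + 1$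
  bounds a term of the Bessel series by two consecutive terms of the exponential series. The factor
  $\sqrt s$ gained here is the decay of $e^{-s} I_0(s)$.
\<close>

lemma bessel_term_le:
  fixes s :: real
  assumes "s > 0"
  shows "2 * sqrt s * ((s / 2) ^ (2 * k) / (fact k)\<^sup>2)
           \<le> s ^ (2 * k) / fact (2 * k) + s ^ Suc (2 * k) / fact (Suc (2 * k))"
proof -
  define x :: real where "x = fact (2 * k) / (4 ^ k * (fact k)\<^sup>2)"
  have "0 \<le> (sqrt s * x - 1)\<^sup>2" by simp
  then have "2 * sqrt s * x \<le> s * x\<^sup>2 + 1"
    using assms by (simp add: power2_diff power_mult_distrib)
  also have "x\<^sup>2 \<le> 1 / (2 * real k + 1)"
    using central_binomial_square_le[of k]
    by (simp add: x_def power_divide field_simps)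
  finally have "2 * sqrt s * x \<le> s * (1 / (2 * real k + 1)) + 1"
    using assms by simp
  then have "s ^ (2 * k) / fact (2 * k) * (2 * sqrt s * x)
      \<le> s ^ (2 * k) / fact (2 * k) * (s * (1 / (2 * real k + 1)) + 1)"
    using assms by (intro mult_left_mono) auto
  also have "\<dots> = s ^ (2 * k) / fact (2 * k) + s ^ Suc (2 * k) / fact (Suc (2 * k))"
  proof -
    have "fact (Suc (2 * k)) = (2 * real k + 1) * (fact (2 * k) :: real)"
      by (simp add: algebra_simps)
    moreover have "2 * real k + 1 \<noteq> 0"
      by linarith
    ultimately show ?thesis
      by (simp only: power_Suc) (simp add: divide_simps del: fact_Suc, simp add: algebra_simps)
  qed
  also have "s ^ (2 * k) / fact (2 * k) * (2 * sqrt s * x) = 2 * sqrt s * ((s / 2) ^ (2 * k) / (fact k)\<^sup>2)"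
    by (simp add: x_def power_divide power_mult)
  finally show ?thesis .
qed

lemma sum_exp_le:
  fixes s :: real
  assumes "s \<ge> 0"
  shows "(\<Sum>j<n. s ^ j / fact j) \<le> exp s"
proof -
  have "(\<lambda>j. s ^ j / fact j) sums exp s"
    using exp_converges[of s] by (simp add: divide_inverse mult.commute)
  then show ?thesis
    using assms by (intro sum_le_suminf[THEN order_trans]) (auto simp: sums_iff)
qed

lemma sum_even_odd: "(\<Sum>k\<le>N. f (2 * k) + f (Suc (2 * k))) = (\<Sum>j<2 * N + 2. f j :: real)"
  by (induction N) auto

lemma bessel_sum_le_decay:
  fixes s :: real
  assumes "s > 0"
  shows "(\<Sum>k\<le>N. (s / 2) ^ (2 * k) / (fact k)\<^sup>2) \<le> exp s / (2 * sqrt s)"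
proof -
  have "2 * sqrt s * (\<Sum>k\<le>N. (s / 2) ^ (2 * k) / (fact k)\<^sup>2)
      \<le> (\<Sum>k\<le>N. s ^ (2 * k) / fact (2 * k) + s ^ Suc (2 * k) / fact (Suc (2 * k)))"
    unfolding sum_distrib_left by (intro sum_mono bessel_term_le assms)
  also have "\<dots> = (\<Sum>j<2 * N + 2. s ^ j / fact j)" by (rule sum_even_odd)
  also have "\<dots> \<le> exp s" using assms by (intro sum_exp_le) auto
  finally show ?thesis
    using assms by (simp add: field_simps)
qed

text \<open>
  The bound $\binom{2k}{k} \le 4^k$ compares with $\cosh s$. It takes over for small $s$, where the
  factor $1/\sqrt s$ of the bound above is large.
\<close>

lemma bessel_sum_le_exp:
  fixes s :: real
  assumes "s \<ge> 0"
  shows "(\<Sum>k\<le>N. (s / 2) ^ (2 * k) / (fact k)\<^sup>2) \<le> exp s"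
proof -
  have "(s / 2) ^ (2 * k) / (fact k)\<^sup>2 \<le> s ^ (2 * k) / fact (2 * k) + s ^ Suc (2 * k) / fact (Suc (2 * k))" for k
  proof -
    have "1 * (fact (2 * k))\<^sup>2 \<le> (2 * real k + 1) * (fact (2 * k))\<^sup>2"
      by (rule mult_right_mono) auto
    also have "\<dots> \<le> (4 ^ k * (fact k)\<^sup>2)\<^sup>2"
      by (rule central_binomial_square_le)
    finally have "fact (2 * k) \<le> 4 ^ k * ((fact k)\<^sup>2 :: real)"
      using power2_le_imp_le by fastforce
    then have "s ^ (2 * k) * fact (2 * k) \<le> s ^ (2 * k) * (4 ^ k * (fact k)\<^sup>2)"
      using assms by (intro mult_left_mono) auto
    then have "s ^ (2 * k) / 4 ^ k / (fact k)\<^sup>2 \<le> s ^ (2 * k) / fact (2 * k)"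
      by (simp add: field_simps)
    then have "(s / 2) ^ (2 * k) / (fact k)\<^sup>2 \<le> s ^ (2 * k) / fact (2 * k)"
      by (simp add: power_divide power_mult)
    moreover have "0 \<le> s ^ Suc (2 * k) / fact (Suc (2 * k))"
      using assms by auto
    ultimately show ?thesis by linarith
  qed
  then have "(\<Sum>k\<le>N. (s / 2) ^ (2 * k) / (fact k)\<^sup>2)
      \<le> (\<Sum>k\<le>N. s ^ (2 * k) / fact (2 * k) + s ^ Suc (2 * k) / fact (Suc (2 * k)))"
    by (intro sum_mono)
  also have "\<dots> = (\<Sum>j<2 * N + 2. s ^ j / fact j)" by (rule sum_even_odd)
  also have "\<dots> \<le> exp s" using assms by (intro sum_exp_le) auto
  finally show ?thesis .
qed

text \<open>
  Euler's integral for $\Gamma(n+1)$; the integrands differ at $t = 0$ when $n = 0$, because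
  \<open>0 powr 0 = 0\<close>.
\<close>

lemma has_integral_exp_power: "((\<lambda>t::real. exp (- t) * t ^ n) has_integral fact n) {0..}"
proof (rule has_integral_spike)
  have "((\<lambda>t. t powr (real n + 1 - 1) / exp t) has_integral Gamma (real n + 1)) {0..}"
    by (rule Gamma_integral_real) simp
  then show "((\<lambda>t. t powr real n / exp t) has_integral fact n) {0..}"
    by (simp add: Gamma_fact add.commute)
  show "exp (- t) * t ^ n = t powr real n / exp t" if "t \<in> {0..} - {0}" for t :: real
    using that by (simp add: powr_realpow exp_minus field_simps)
qed simp

section \<open>Summability of the Lauricella series\<close>

text \<open>
  The probability that a walk of $2|k|$ steps makes exactly $k_i$ forward and $k_i$ backward steps in
  every direction $i$.
\<close>

definition loop_weight :: "nat ^ 'd \<Rightarrow> real" where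
  "loop_weight k = fact (2 * (\<Sum>i\<in>UNIV. k $ i)) /
     ((2 * real CARD('d)) ^ (2 * (\<Sum>i\<in>UNIV. k $ i)) * (\<Prod>i\<in>UNIV. (fact (k $ i))\<^sup>2))"

lemma loop_weight_nonneg: "loop_weight k \<ge> 0"
  by (simp add: loop_weight_def prod_nonneg)

lemma lauricella_FC_term_eq_loop_weight:
  fixes k :: "nat ^ 'd"
  shows
  "lauricella_FC_term (1::real) (1/2) (\<chi> i::'d. 1) (\<chi> i. 1 / (real CARD('d))\<^sup>2) k = loop_weight k"
proof -
  define n where "n = (\<Sum>i\<in>UNIV. k $ i)"
  have pochhammers: "pochhammer 1 n * pochhammer (1/2) n = fact (2 * n) / (4::real) ^ n"
    using fact_double[of n, where 'a = real] by (simp add: pochhammer_fact[symmetric] power_mult)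
  have powers: "(\<Prod>i\<in>UNIV. (1 / (real CARD('d))\<^sup>2) ^ (k $ i)) = 1 / real CARD('d) ^ (2 * n)"
    unfolding power_sum[symmetric] n_def[symmetric] by (simp add: power_mult power_divide)
  have facts: "(\<Prod>i\<in>UNIV. (fact (k $ i))\<^sup>2) =
      (\<Prod>i\<in>UNIV. fact (k $ i)) * (\<Prod>i\<in>UNIV. fact (k $ i) :: real)"
    by (simp add: power2_eq_square prod.distrib)
  have "(2 * real CARD('d)) ^ (2 * n) = 4 ^ n * real CARD('d) ^ (2 * n)"
    by (simp add: power_mult_distrib power_mult)
  then show ?thesis
    unfolding lauricella_FC_term_def loop_weight_def n_def[symmetric] vec_lambda_beta
      pochhammers powers facts
    by (simp add: pochhammer_fact[symmetric])
qed

lemma loop_weight_has_integral: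
  fixes k :: "nat ^ 'd"
  shows "((\<lambda>t. exp (- t) * (\<Prod>i\<in>UNIV. ((t / real CARD('d)) / 2) ^ (2 * k $ i) / (fact (k $ i))\<^sup>2))
          has_integral loop_weight k) {0..}"
proof -
  define n where "n = (\<Sum>i\<in>UNIV. k $ i)"
  define c where "c = 1 / ((2 * real CARD('d)) ^ (2 * n) * (\<Prod>i\<in>UNIV. (fact (k $ i))\<^sup>2))"
  have "((\<lambda>t. exp (- t) * t ^ (2 * n) * c) has_integral fact (2 * n) * c) {0..}"
    by (intro has_integral_mult_left has_integral_exp_power)
  moreover have "fact (2 * n) * c = loop_weight k"
    by (simp add: loop_weight_def c_def n_def)
  moreover have "(\<Prod>i\<in>UNIV. ((t / real CARD('d)) / 2) ^ (2 * k $ i) / (fact (k $ i))\<^sup>2) = t ^ (2 * n) * c" for t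
  proof -
    have "(\<Prod>i\<in>UNIV. ((t / real CARD('d)) / 2) ^ (2 * k $ i)) = ((t / real CARD('d)) / 2) ^ (2 * n)"
      by (simp add: n_def power_sum sum_distrib_left)
    then have "(\<Prod>i\<in>UNIV. ((t / real CARD('d)) / 2) ^ (2 * k $ i) / (fact (k $ i))\<^sup>2) =
        ((t / real CARD('d)) / 2) ^ (2 * n) / (\<Prod>i\<in>UNIV. (fact (k $ i))\<^sup>2)"
      by (simp only: prod_dividef)
    then show ?thesis
      by (simp add: c_def power_divide power_mult_distrib)
  qed
  ultimately show ?thesis by (simp add: mult.assoc)
qed

lemma sum_prod_box:
  fixes g :: "nat \<Rightarrow> real"
  shows "(\<Sum>k\<in>{k :: nat ^ 'd. \<forall>i. k $ i \<le> N}. \<Prod>i\<in>UNIV. g (k $ i)) = (\<Sum>j\<le>N. g j) ^ CARD('d)"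
proof -
  have "(\<Sum>k\<in>{k :: nat ^ 'd. \<forall>i. k $ i \<le> N}. \<Prod>i\<in>UNIV. g (k $ i)) =
        (\<Sum>f\<in>PiE (UNIV :: 'd set) (\<lambda>_. {..N}). \<Prod>i\<in>UNIV. g (f i))"
    by (rule sum.reindex_bij_witness[where i = vec_lambda and j = vec_nth]) auto
  also have "\<dots> = (\<Prod>i\<in>(UNIV :: 'd set). \<Sum>j\<le>N. g j)"
    by (rule prod_sum_PiE[symmetric]) auto
  finally show ?thesis by simp
qed

lemma finite_box: "finite {k :: nat ^ 'd. \<forall>i. k $ i \<le> N}"
proof (rule finite_subset)
  show "{k :: nat ^ 'd. \<forall>i. k $ i \<le> N} \<subseteq> vec_lambda ` PiE (UNIV :: 'd set) (\<lambda>_. {..N})"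
    by (auto intro!: image_eqI[where x = "vec_nth _"])
qed (intro finite_imageI finite_PiE; simp)

text \<open>
  The majorant $h$ of the integrand is $\min(1, (t/d)^{-3/2})$; its exponent $-3/2 < -1$, and with it
  the convergence at infinity, is what $d \ge 3$ provides.
\<close>

lemma loop_weight_box_le:
  assumes "CARD('d) \<ge> 3"
  shows "(\<Sum>k\<in>{k :: nat ^ 'd. \<forall>i. k $ i \<le> N}. loop_weight k) \<le> 3 * real CARD('d)"
proof -
  define d where "d = real CARD('d)"
  have d: "d > 0" by (simp add: d_def)
  define B where "B s = (\<Sum>k\<le>N. (s / 2) ^ (2 * k) / (fact k)\<^sup>2)" for s :: real
  define h where "h t = (if t \<le> d then 1 else (t / d) powr (-3/2))" for t
  have "((\<lambda>t. \<Sum>k\<in>{k :: nat ^ 'd. \<forall>i. k $ i \<le> N}.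
            exp (- t) * (\<Prod>i\<in>UNIV. ((t / d) / 2) ^ (2 * k $ i) / (fact (k $ i))\<^sup>2))
          has_integral (\<Sum>k\<in>{k :: nat ^ 'd. \<forall>i. k $ i \<le> N}. loop_weight k)) {0..}"
    unfolding d_def by (intro has_integral_sum finite_box loop_weight_has_integral)
  moreover have "(\<Sum>k\<in>{k :: nat ^ 'd. \<forall>i. k $ i \<le> N}.
        exp (- t) * (\<Prod>i\<in>UNIV. ((t / d) / 2) ^ (2 * k $ i) / (fact (k $ i))\<^sup>2)) =
      exp (- t) * B (t / d) ^ CARD('d)" for t
    unfolding sum_distrib_left[symmetric] B_def
    by (subst sum_prod_box[of "\<lambda>j. (t / d / 2) ^ (2 * j) / (fact j)\<^sup>2"]) simp
  ultimately have int: "((\<lambda>t. exp (- t) * B (t / d) ^ CARD('d))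
          has_integral (\<Sum>k\<in>{k :: nat ^ 'd. \<forall>i. k $ i \<le> N}. loop_weight k)) {0..}"
    by simp
  have "(h has_integral d) {0..d}"
    using has_integral_const_real[of "1::real" 0 d] d
    by (subst has_integral_cong[where g = "\<lambda>_. 1"]) (auto simp: h_def)
  moreover have "(h has_integral 2 * d) {d..}"
  proof -
    have eq: "h t = d powr (3/2) * t powr (-3/2)" if "t \<in> {d..}" for t
    proof -
      have "(t / d) powr (-3/2) = d powr (3/2) * t powr (-3/2)"
        using that d by (simp add: powr_divide powr_minus field_simps)
      moreover have "h t = (t / d) powr (-3/2)"
        using that d by (auto simp: h_def)
      ultimately show ?thesis by simp
    qed
    have "((\<lambda>t. d powr (3/2) * t powr (-3/2)) has_integral
        d powr (3/2) * (- (d powr (-3/2 + 1)) / (-3/2 + 1))) {d..}"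
      using d by (intro has_integral_mult_right has_integral_powr_to_inf) auto
    moreover have "d powr (3/2) * (- (d powr (-3/2 + 1)) / (-3/2 + 1)) = 2 * d"
      using d by (simp add: powr_add[symmetric])
    ultimately have "((\<lambda>t. d powr (3/2) * t powr (-3/2)) has_integral 2 * d) {d..}"
      by (simp only:)
    then show ?thesis
      by (subst has_integral_cong[OF eq])
  qed
  ultimately have "(h has_integral (d + 2 * d)) ({0..d} \<union> {d..})"
    by (rule has_integral_Un) (use d in \<open>simp add: Int_absorb1\<close>)
  moreover have "{0..d} \<union> {d..} = {0..}"
    using d by auto
  ultimately have inth: "(h has_integral 3 * d) {0..}" by simp
  have "exp (- t) * B (t / d) ^ CARD('d) \<le> h t" if "t \<in> {0..}" for t
  proof -
    have t: "t \<ge> 0" using that by simp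
    have B0: "B (t / d) \<ge> 0"
      unfolding B_def by (intro sum_nonneg) auto
    have e: "exp (- t) * exp (t / d) ^ CARD('d) = 1"
      using d by (simp add: exp_of_nat_mult[symmetric] d_def exp_add[symmetric])
    show ?thesis
    proof (cases "t \<le> d")
      case True
      have "exp (- t) * B (t / d) ^ CARD('d) \<le> exp (- t) * exp (t / d) ^ CARD('d)"
        using t d B0 unfolding B_def
        by (intro mult_left_mono power_mono bessel_sum_le_exp) (auto simp: B_def)
      with e True show ?thesis by (simp add: h_def)
    next
      case False
      define s where "s = t / d"
      have s: "s > 1" using False d by (simp add: s_def)
      have "exp (- t) * B s ^ CARD('d) \<le> exp (- t) * (exp s / (2 * sqrt s)) ^ CARD('d)"
        using s B0 unfolding B_def s_def
        by (intro mult_left_mono power_mono bessel_sum_le_decay) (auto simp: B_def)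
      also have "\<dots> = (1 / (2 * sqrt s)) ^ CARD('d)"
        using e by (simp add: power_divide s_def)
      also have "\<dots> \<le> (1 / (2 * sqrt s)) ^ 3"
      proof (rule power_decreasing[OF assms])
        have "1 \<le> sqrt s" using s by simp
        then have "1 \<le> 2 * sqrt s" by linarith
        then show "1 / (2 * sqrt s) \<le> 1" using s by (subst divide_le_eq_1_pos) auto
      qed (use s in auto)
      also have "\<dots> \<le> (1 / sqrt s) ^ 3"
        using s by (intro power_mono) (auto simp: field_simps)
      also have "\<dots> = s powr (-3/2)"
      proof -
        have "1 / sqrt s = s powr (-1/2)"
          using s by (simp add: powr_half_sqrt[symmetric] powr_minus_divide)
        then show ?thesis
          using s by (simp add: powr_power)
      qed
      finally show ?thesis using False by (simp add: h_def s_def)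
    qed
  qed
  from has_integral_le[OF int inth this] show ?thesis by (simp add: d_def)
qed

lemma loop_weight_summable:
  assumes "CARD('d) \<ge> 3"
  shows "(loop_weight :: nat ^ 'd \<Rightarrow> real) summable_on UNIV"
proof (rule nonneg_bdd_above_summable_on)
  show "bdd_above (sum (loop_weight :: nat ^ 'd \<Rightarrow> real) ` {F. F \<subseteq> UNIV \<and> finite F})"
  proof (rule bdd_aboveI2)
    fix F :: "(nat ^ 'd) set"
    assume "F \<in> {F. F \<subseteq> UNIV \<and> finite F}"
    then have F: "finite F" by simp
    define N where "N = (\<Sum>k\<in>F. \<Sum>i\<in>UNIV. k $ i)"
    have "k $ i \<le> N" if "k \<in> F" for k i
    proof -
      have "k $ i \<le> (\<Sum>i\<in>UNIV. k $ i)" by (rule member_le_sum) auto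
      also have "\<dots> \<le> N" unfolding N_def by (rule member_le_sum[OF that]) (use F in auto)
      finally show ?thesis .
    qed
    then have "sum loop_weight F \<le> sum loop_weight {k :: nat ^ 'd. \<forall>i. k $ i \<le> N}"
      by (intro sum_mono2 finite_box) (auto simp: loop_weight_nonneg)
    also have "\<dots> \<le> 3 * real CARD('d)" by (rule loop_weight_box_le[OF assms])
    finally show "sum loop_weight F \<le> 3 * real CARD('d)" .
  qed
qed (rule loop_weight_nonneg)

section \<open>Renewal equation for closed walks\<close>

definition walks :: "nat \<Rightarrow> (int ^ 'd) list set" where
  "walks n = {xs. set xs \<subseteq> unit_steps \<and> length xs = n}"

definition loops :: "nat \<Rightarrow> (int ^ 'd) list set" where
  "loops n = {xs \<in> walks n. sum_list xs = 0}"

definition first_loops :: "nat \<Rightarrow> (int ^ 'd) list set" where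
  "first_loops n = {xs \<in> loops n. 0 < n \<and> (\<forall>m. 0 < m \<and> m < n \<longrightarrow> sum_list (take m xs) \<noteq> 0)}"

lemma finite_unit_steps: "finite (unit_steps :: (int ^ 'd) set)"
  using card_unit_steps[where 'd = 'd] by (auto intro: card_ge_0_finite)

lemma finite_walks: "finite (walks n :: (int ^ 'd) list set)"
  unfolding walks_def by (rule finite_lists_length_eq[OF finite_unit_steps])

lemma card_walks: "card (walks n :: (int ^ 'd) list set) = (2 * CARD('d)) ^ n"
  unfolding walks_def by (simp add: card_lists_length_eq[OF finite_unit_steps] card_unit_steps)

lemma first_loops_subset: "first_loops n \<subseteq> loops n" and loops_subset: "loops n \<subseteq> walks n"
  by (auto simp: first_loops_def loops_def)

lemma finite_loops: "finite (loops n)" and finite_first_loops: "finite (first_loops n)"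
  using first_loops_subset loops_subset finite_walks by (meson finite_subset)+

lemma loops_0: "loops 0 = {[]}"
  by (auto simp: loops_def walks_def)

text \<open>
  A nonempty closed walk splits uniquely into its part up to the first return to the origin and a
  closed walk.
\<close>

lemma card_loops_renewal:
  assumes "n > 0"
  shows "card (loops n :: (int ^ 'd) list set) =
    (\<Sum>k\<le>n. card (first_loops k :: (int ^ 'd) list set) * card (loops (n - k) :: (int ^ 'd) list set))"
proof -
  let ?A = "SIGMA k:{..n}. (first_loops k :: (int ^ 'd) list set) \<times> (loops (n - k) :: (int ^ 'd) list set)"
  have len: "length xs = k" if "xs \<in> loops k" for xs :: "(int ^ 'd) list" and k
    using that by (simp add: loops_def walks_def)
  have "bij_betw (\<lambda>(k, xs, ys). xs @ ys) ?A (loops n)"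
    unfolding bij_betw_def
  proof
    have aux: "\<not> k < k'" if xs: "xs \<in> first_loops k" and xs': "xs' \<in> first_loops k'" and eq: "xs @ ys = xs' @ ys'"
      for k k' and xs ys xs' ys' :: "(int ^ 'd) list"
    proof
      assume less: "k < k'"
      have "take k (xs @ ys) = xs" "take k (xs' @ ys') = take k xs'"
        using len[of xs k] len[of xs' k'] xs xs' less by (simp_all add: first_loops_def)
      then have "sum_list (take k xs') = 0" "k > 0"
        using eq xs by (auto simp: first_loops_def loops_def)
      then show False using xs' less by (simp add: first_loops_def)
    qed
    show "inj_on (\<lambda>(k, xs, ys). xs @ ys) ?A"
    proof (rule inj_onI; clarsimp)
      fix k k' and xs ys xs' ys' :: "(int ^ 'd) list"
      assume xs: "xs \<in> first_loops k" and xs': "xs' \<in> first_loops k'" and eq: "xs @ ys = xs' @ ys'"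
      have "k = k'" using aux[OF xs xs' eq] aux[OF xs' xs eq[symmetric]] by simp
      moreover have "length xs = k" "length xs' = k'"
        using len xs xs' first_loops_subset by (auto dest: subsetD)
      ultimately show "k = k' \<and> xs = xs' \<and> ys = ys'" using eq by simp
    qed
    show "(\<lambda>(k, xs, ys). xs @ ys) ` ?A = loops n"
    proof
      show "(\<lambda>(k, xs, ys). xs @ ys) ` ?A \<subseteq> loops n"
        by (auto simp: first_loops_def loops_def walks_def)
      show "loops n \<subseteq> (\<lambda>(k, xs, ys). xs @ ys) ` ?A"
      proof
        fix zs :: "(int ^ 'd) list"
        assume zs: "zs \<in> loops n"
        \<comment> \<open>Cut at the first positive time at which the partial sum of the steps vanishes.\<close>
        define P where "P k \<longleftrightarrow> 0 < k \<and> sum_list (take k zs) = 0" for k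
        have Pn: "P n" using zs assms by (auto simp: P_def loops_def walks_def)
        define k where "k = (LEAST k. P k)"
        have k: "P k" "k \<le> n" using Pn by (auto simp: k_def intro: LeastI Least_le)
        have min: "\<not> P m" if "m < k" for m using that not_less_Least by (auto simp: k_def)
        have "take k zs \<in> first_loops k"
          using zs k min by (auto simp: first_loops_def loops_def walks_def P_def min_def dest: in_set_takeD)
        moreover have "drop k zs \<in> loops (n - k)"
        proof -
          have "sum_list (take k zs) + sum_list (drop k zs) = sum_list zs"
            by (metis append_take_drop_id sum_list_append)
          then show ?thesis
            using zs k by (auto simp: loops_def walks_def P_def dest: in_set_dropD)
        qed
        ultimately show "zs \<in> (\<lambda>(k, xs, ys). xs @ ys) ` ?A"
          using k by (intro image_eqI[where x = "(k, take k zs, drop k zs)"]) auto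
      qed
    qed
  qed
  then have "card (loops n :: (int ^ 'd) list set) = card ?A"
    by (simp add: bij_betw_same_card)
  also have "\<dots> = (\<Sum>k\<le>n. card ((first_loops k :: (int ^ 'd) list set) \<times> (loops (n - k) :: (int ^ 'd) list set)))"
    by (rule card_SigmaI) (simp_all add: finite_loops finite_first_loops)
  finally show ?thesis by (simp add: card_cartesian_product)
qed

section \<open>Closed walks and multi-indices\<close>

text \<open>
  The steps of a closed walk, without their order, when it goes \<open>k $ i\<close> times forwards and as often
  backwards in direction \<open>i\<close>.
\<close>

definition balanced_steps :: "nat ^ 'd \<Rightarrow> (int ^ 'd) multiset" where
  "balanced_steps k = (\<Sum>i\<in>UNIV. replicate_mset (k $ i) (axis i 1) + replicate_mset (k $ i) (axis i (- 1)))"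

lemma count_balanced_steps: "count (balanced_steps k) u = (\<Sum>i\<in>UNIV. if u = axis i 1 \<or> u = axis i (-1) then k $ i else 0)"
  unfolding balanced_steps_def count_sum
  by (intro sum.cong refl) (auto simp: axis_eq_axis)

lemma count_balanced_steps_axis:
  assumes "s = 1 \<or> s = -1"
  shows "count (balanced_steps k) (axis i s) = k $ i"
proof -
  have "count (balanced_steps k) (axis i s) = (\<Sum>j\<in>UNIV. if j = i then k $ j else 0)"
    unfolding count_balanced_steps using assms by (intro sum.cong refl) (auto simp: axis_eq_axis)
  then show ?thesis by simp
qed

lemma set_balanced_steps: "set_mset (balanced_steps k) \<subseteq> unit_steps"
proof
  fix u assume "u \<in># balanced_steps k"
  then obtain i where "u = axis i 1 \<or> u = axis i (- 1)"
    by (auto simp: balanced_steps_def set_mset_sum split: if_splits)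
  then show "u \<in> unit_steps"
    unfolding unit_steps_def by blast
qed

lemma size_balanced_steps: "size (balanced_steps k) = 2 * (\<Sum>i\<in>UNIV. k $ i)"
  by (simp add: balanced_steps_def size_multiset_sum sum.distrib)

lemma sum_list_walk_component:
  assumes "set xs \<subseteq> unit_steps"
  shows "sum_list xs $ i = int (count (mset xs) (axis i 1)) - int (count (mset xs) (axis i (- 1)))"
  using assms
proof (induction xs)
  case (Cons x xs)
  then obtain j s where x: "x = axis j s" "s = 1 \<or> s = -1" by (auto simp: unit_steps_def)
  then have "x $ i = (if i = j then s else 0)" by (simp add: axis_def)
  then show ?case using Cons x by (auto simp: axis_eq_axis)
qed simp

text \<open>
  The displacement in direction $i$ is the difference of the numbers of forward and backward steps,
  so a walk is closed precisely when its multiset of steps is balanced.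
\<close>

lemma loops_eq_UN:
  "(loops m :: (int ^ 'd) list set) =
     (\<Union>k\<in>{k. 2 * (\<Sum>i\<in>UNIV. k $ i) = m}. permutations_of_multiset (balanced_steps k))"
proof (intro equalityI subsetI)
  fix xs :: "(int ^ 'd) list"
  assume xs: "xs \<in> loops m"
  define k :: "nat ^ 'd" where "k = (\<chi> i. count (mset xs) (axis i 1))"
  have k: "count (mset xs) (axis i s) = k $ i" if "s = 1 \<or> s = -1" for i s
    using xs that sum_list_walk_component[of xs i] by (auto simp: loops_def walks_def k_def)
  have "mset xs = balanced_steps k"
  proof (rule multiset_eqI)
    fix u
    show "count (mset xs) u = count (balanced_steps k) u"
    proof (cases "u \<in> unit_steps")
      case True
      then show ?thesis by (auto simp: unit_steps_def k count_balanced_steps_axis)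
    next
      case False
      then have "u \<notin># mset xs" "u \<notin># balanced_steps k"
        using xs set_balanced_steps[of k] by (auto simp: loops_def walks_def)
      then show ?thesis by (simp add: not_in_iff)
    qed
  qed
  moreover from this have "2 * (\<Sum>i\<in>UNIV. k $ i) = m"
    using xs by (simp add: size_balanced_steps[symmetric] loops_def walks_def flip: size_mset)
  ultimately show "xs \<in> (\<Union>k\<in>{k. 2 * (\<Sum>i\<in>UNIV. k $ i) = m}. permutations_of_multiset (balanced_steps k))"
    by (auto simp: permutations_of_multiset_def)
next
  fix xs :: "(int ^ 'd) list"
  assume "xs \<in> (\<Union>k\<in>{k. 2 * (\<Sum>i\<in>UNIV. k $ i) = m}. permutations_of_multiset (balanced_steps k))"
  then obtain k where k: "2 * (\<Sum>i\<in>UNIV. k $ i) = m" "mset xs = balanced_steps k"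
    by (auto simp: permutations_of_multiset_def)
  have set: "set xs \<subseteq> unit_steps" 
    using set_balanced_steps[of k] unfolding k(2)[symmetric] by simp
  moreover have "length xs = m" 
    using size_balanced_steps[of k] unfolding k(2)[symmetric] k(1) by simp
  moreover have "sum_list xs = 0"
    by (simp add: vec_eq_iff sum_list_walk_component[OF set] k(2) count_balanced_steps_axis)
  ultimately show "xs \<in> loops m" by (simp add: loops_def walks_def)
qed

lemma card_permutations_balanced_steps:
  "real (card (permutations_of_multiset (balanced_steps k))) =
     fact (2 * (\<Sum>i\<in>UNIV. k $ i)) / (\<Prod>i\<in>UNIV. (fact (k $ i))\<^sup>2)"
proof -
  let ?A = "balanced_steps k"
  have "(\<Prod>x\<in>set_mset ?A. fact (count ?A x) :: nat) = (\<Prod>x\<in>unit_steps. fact (count ?A x))"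
    by (rule prod.mono_neutral_left) (use finite_unit_steps set_balanced_steps in \<open>auto simp: not_in_iff\<close>)
  also have "(unit_steps :: (int ^ 'a) set) = (\<lambda>(i, s). axis i s) ` (UNIV \<times> {1, -1})"
    unfolding unit_steps_def by auto
  also have "(\<Prod>x\<in>(\<lambda>(i, s). axis i s) ` (UNIV \<times> {1, -1}). fact (count ?A x)) =
     (\<Prod>(i, s)\<in>UNIV \<times> {1, -1}. fact (count ?A (axis i s)) :: nat)"
    by (subst prod.reindex) (auto simp: inj_on_def axis_eq_axis case_prod_beta)
  also have "\<dots> = (\<Prod>i\<in>UNIV. (fact (k $ i))\<^sup>2)"
    by (simp flip: prod.cartesian_product add: count_balanced_steps_axis power2_eq_square)
  finally have *: "(\<Prod>x\<in>set_mset ?A. fact (count ?A x)) = (\<Prod>i\<in>UNIV. (fact (k $ i))\<^sup>2 :: nat)" .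
  have "fact (size ?A) = (\<Prod>i\<in>UNIV. (fact (k $ i))\<^sup>2) * card (permutations_of_multiset ?A)"
    using card_permutations_of_multiset_aux[of ?A] by (simp add: * mult.commute)
  then have "real (fact (size ?A)) = real (\<Prod>i\<in>UNIV. (fact (k $ i))\<^sup>2) * card (permutations_of_multiset ?A)"
    by (metis of_nat_mult)
  then show ?thesis by (simp add: size_balanced_steps field_simps)
qed

lemma finite_multi_indices: "finite {k :: nat ^ 'd. 2 * (\<Sum>i\<in>UNIV. k $ i) = m}"
proof (rule finite_subset[OF _ finite_box])
  have "k $ i \<le> (\<Sum>i\<in>UNIV. k $ i)" for k :: "nat ^ 'd" and i
    by (rule member_le_sum) auto
  then have "k $ i \<le> 2 * (\<Sum>i\<in>UNIV. k $ i)" for k :: "nat ^ 'd" and i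
    by (rule order_trans) simp
  then show "{k :: nat ^ 'd. 2 * (\<Sum>i\<in>UNIV. k $ i) = m} \<subseteq> {k. \<forall>i. k $ i \<le> m}"
    by auto
qed

lemma card_loops_eq_sum:
  "card (loops m :: (int ^ 'd) list set) / (2 * real CARD('d)) ^ m =
     (\<Sum>k\<in>{k :: nat ^ 'd. 2 * (\<Sum>i\<in>UNIV. k $ i) = m}. loop_weight k)"
proof -
  have inj: "k = k'" if "xs \<in> permutations_of_multiset (balanced_steps k)"
      "xs \<in> permutations_of_multiset (balanced_steps k')" for xs and k k' :: "nat ^ 'd"
    using that count_balanced_steps_axis[of 1 k] count_balanced_steps_axis[of 1 k']
    by (simp add: vec_eq_iff permutations_of_multiset_def)
  have "card (loops m :: (int ^ 'd) list set) =
      (\<Sum>k\<in>{k :: nat ^ 'd. 2 * (\<Sum>i\<in>UNIV. k $ i) = m}. card (permutations_of_multiset (balanced_steps k)))"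
    unfolding loops_eq_UN
    by (rule card_UN_disjoint[OF finite_multi_indices])
      (simp, use inj in blast)+
  then show ?thesis
    by (auto simp: sum_divide_distrib card_permutations_balanced_steps loop_weight_def mult.commute intro!: sum.cong)
qed

text \<open>
  Grouping the multi-indices by $2|k|$ leaves an empty group for every odd length, in accordance
  with the absence of closed walks of odd length.
\<close>

lemma loop_series_sums:
  assumes "CARD('d) \<ge> 3"
  shows "(\<lambda>m. card (loops m :: (int ^ 'd) list set) / (2 * real CARD('d)) ^ m) sums
           infsum (loop_weight :: nat ^ 'd \<Rightarrow> real) UNIV"
proof -
  let ?A = "\<lambda>m. {k :: nat ^ 'd. 2 * (\<Sum>i\<in>UNIV. k $ i) = m}"
  let ?w = "loop_weight :: nat ^ 'd \<Rightarrow> real"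
  have "(?w has_sum infsum ?w UNIV) UNIV"
    by (rule has_sum_infsum[OF loop_weight_summable[OF assms]])
  then have "((\<lambda>p. ?w (snd p)) has_sum infsum ?w UNIV) (Sigma UNIV ?A)"
    by (subst has_sum_reindex_bij_witness[where T = UNIV and j = snd and
          i = "\<lambda>k. (2 * (\<Sum>i\<in>UNIV. k $ i), k)" and h = ?w and s' = "infsum ?w UNIV"]) auto
  then have "((\<lambda>m. sum ?w (?A m)) has_sum infsum ?w UNIV) UNIV"
    by (rule has_sum_SigmaD) (use finite_multi_indices in \<open>auto intro!: has_sum_finite\<close>)
  then show ?thesis
    unfolding card_loops_eq_sum by (rule has_sum_imp_sums)
qed

section \<open>First returns of the random walk\<close>

text \<open>
  Independence makes all walks of length $n$ equally likely as sequences of the first $n$ increments.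
  As there are $(2d)^n$ of them, their probabilities add up to 1, so that the increments are almost
  surely unit steps.
\<close>

lemma
  fixes M :: "'a measure" and S :: "nat \<Rightarrow> 'a \<Rightarrow> int ^ 'd"
  assumes walk: "simple_random_walk M S"
  shows measurable_walk: "S n \<in> M \<rightarrow>\<^sub>M count_space UNIV"
    and increments_in_events: "W \<subseteq> walks n \<Longrightarrow>
      {\<omega>\<in>space M. map (\<lambda>i. S (Suc i) \<omega> - S i \<omega>) [0..<n] \<in> W} \<in> sets M"
    and prob_increments_in: "W \<subseteq> walks n \<Longrightarrow>
      measure M {\<omega>\<in>space M. map (\<lambda>i. S (Suc i) \<omega> - S i \<omega>) [0..<n] \<in> W} = card W / (2 * real CARD('d)) ^ n"
    and AE_increments: "AE \<omega> in M. map (\<lambda>i. S (Suc i) \<omega> - S i \<omega>) [0..<n] \<in> walks n"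
proof -
  interpret prob_space M using walk by (simp add: simple_random_walk_def)
  define X where "X n \<omega> = S (Suc n) \<omega> - S n \<omega>" for n \<omega>
  have indep: "indep_vars (\<lambda>_. count_space UNIV) X UNIV"
    using walk by (simp add: simple_random_walk_def X_def[abs_def])
  have X [measurable]: "X n \<in> M \<rightarrow>\<^sub>M count_space UNIV" for n
    using indep by (auto simp: indep_vars_def)
  have PX: "prob {\<omega>\<in>space M. X n \<omega> = u} = 1 / (2 * real CARD('d))" if "u \<in> unit_steps" for n u
    using walk that by (simp add: simple_random_walk_def X_def)
  show S: "S n \<in> M \<rightarrow>\<^sub>M count_space UNIV" for n
  proof (induction n)
    case 0
    have "(\<lambda>_. 0) \<in> M \<rightarrow>\<^sub>M count_space UNIV" by simp
    then show ?case
      by (rule measurable_cong[THEN iffD1, rotated]) (use walk in \<open>simp add: simple_random_walk_def\<close>)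
  next
    case (Suc n)
    have "(\<lambda>\<omega>. X n \<omega> + S n \<omega>) \<in> M \<rightarrow>\<^sub>M count_space UNIV"
      by (rule measurable_compose_countable[OF _ Suc]) (auto intro: measurable_compose[OF X])
    then show ?case by (simp add: X_def)
  qed
  have map: "map (\<lambda>i. S (Suc i) \<omega> - S i \<omega>) [0..<n] = map (\<lambda>i. X i \<omega>) [0..<n]" for \<omega> n
    by (simp add: X_def)
  have eq: "{\<omega>\<in>space M. map (\<lambda>i. X i \<omega>) [0..<n] = xs} = {\<omega>\<in>space M. \<forall>i<n. X i \<omega> = xs ! i}"
    if "length xs = n" for n xs
    using that by (auto simp: list_eq_iff_nth_eq)
  have meas: "{\<omega>\<in>space M. map (\<lambda>i. X i \<omega>) [0..<n] = xs} \<in> events" if "length xs = n" for n xs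
    unfolding eq[OF that] by measurable
  have single: "prob {\<omega>\<in>space M. map (\<lambda>i. X i \<omega>) [0..<n] = xs} = 1 / (2 * real CARD('d)) ^ n"
    if xs: "xs \<in> walks n" for n xs
  proof (cases "n = 0")
    case True
    with xs show ?thesis by (simp add: walks_def prob_space)
  next
    case False
    have len: "length xs = n" using xs by (simp add: walks_def)
    have "{\<omega>\<in>space M. \<forall>i<n. X i \<omega> = xs ! i} = (\<Inter>i\<in>{..<n}. X i -` {xs ! i} \<inter> space M)"
      using False by auto
    then have "prob {\<omega>\<in>space M. \<forall>i<n. X i \<omega> = xs ! i} = (\<Prod>i<n. prob (X i -` {xs ! i} \<inter> space M))"
      using False by (simp only:, intro indep_varsD[OF indep]) auto
    also have "\<dots> = (\<Prod>i<n. 1 / (2 * real CARD('d)))"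
    proof (rule prod.cong[OF refl])
      fix i assume "i \<in> {..<n}"
      then have "xs ! i \<in> unit_steps" using xs by (auto simp: walks_def)
      moreover have "X i -` {xs ! i} \<inter> space M = {\<omega>\<in>space M. X i \<omega> = xs ! i}" by auto
      ultimately show "prob (X i -` {xs ! i} \<inter> space M) = 1 / (2 * real CARD('d))"
        by (simp add: PX)
    qed
    finally show ?thesis by (simp add: eq[OF len] power_divide)
  qed
  have set: "{\<omega>\<in>space M. map (\<lambda>i. X i \<omega>) [0..<n] \<in> W} =
      (\<Union>xs\<in>W. {\<omega>\<in>space M. map (\<lambda>i. X i \<omega>) [0..<n] = xs})" for n W
    by auto
  have setE: "{\<omega>\<in>space M. map (\<lambda>i. X i \<omega>) [0..<n] \<in> W} \<in> events" if W: "W \<subseteq> walks n" for n W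
    unfolding set using W by (intro sets.finite_UN meas) (auto simp: walks_def intro: finite_subset[OF W finite_walks])
  then show "{\<omega>\<in>space M. map (\<lambda>i. S (Suc i) \<omega> - S i \<omega>) [0..<n] \<in> W} \<in> sets M" if "W \<subseteq> walks n"
    using that by (simp only: map)
  have prob: "prob {\<omega>\<in>space M. map (\<lambda>i. X i \<omega>) [0..<n] \<in> W} = card W / (2 * real CARD('d)) ^ n"
    if W: "W \<subseteq> walks n" for n W
  proof -
    have "prob {\<omega>\<in>space M. map (\<lambda>i. X i \<omega>) [0..<n] \<in> W} =
        (\<Sum>xs\<in>W. prob {\<omega>\<in>space M. map (\<lambda>i. X i \<omega>) [0..<n] = xs})"
      unfolding set
      by (rule finite_measure_finite_Union)
        (use W in \<open>auto simp: disjoint_family_on_def walks_def intro!: meas intro: finite_subset[OF W finite_walks]\<close>)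
    also have "\<dots> = (\<Sum>xs\<in>W. 1 / (2 * real CARD('d)) ^ n)"
      using W by (intro sum.cong single) auto
    finally show ?thesis by simp
  qed
  show "measure M {\<omega>\<in>space M. map (\<lambda>i. S (Suc i) \<omega> - S i \<omega>) [0..<n] \<in> W} = card W / (2 * real CARD('d)) ^ n"
    if "W \<subseteq> walks n" using prob[OF that] by (simp only: map)
  have "prob {\<omega>\<in>space M. map (\<lambda>i. X i \<omega>) [0..<n] \<in> walks n} = 1"
    using prob[of "walks n" n] by (simp add: card_walks)
  then show "AE \<omega> in M. map (\<lambda>i. S (Suc i) \<omega> - S i \<omega>) [0..<n] \<in> walks n"
    unfolding map using setE[of "walks n" n] by (subst (asm) prob_Collect_eq_1) auto
qed

lemma walk_eq_sum_increments:
  assumes "simple_random_walk M S" "\<omega> \<in> space M"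
  shows "S n \<omega> = sum_list (map (\<lambda>i. S (Suc i) \<omega> - S i \<omega>) [0..<n])"
  using assms by (induction n) (auto simp: simple_random_walk_def)

text \<open>
  The event of a return is the disjoint union over $n$ of the events of a first return at time $n$.
  Up to a null set, on which some increment is not a unit step, the latter says that the first $n$
  increments form a first loop.
\<close>

lemma return_probability_sums:
  fixes M :: "'a measure" and S :: "nat \<Rightarrow> 'a \<Rightarrow> int ^ 'd"
  assumes walk: "simple_random_walk M S"
  shows "(\<lambda>n. card (first_loops n :: (int ^ 'd) list set) / (2 * real CARD('d)) ^ n) sums return_probability M S"
proof -
  interpret prob_space M using walk by (simp add: simple_random_walk_def)
  note [measurable] = measurable_walk[OF walk]
  define E where "E n = {\<omega>\<in>space M. 0 < n \<and> S n \<omega> = 0 \<and> (\<forall>m\<in>{0<..<n}. S m \<omega> \<noteq> 0)}" for n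
  have E: "E n \<in> events" for n unfolding E_def by measurable
  have sums: "(\<lambda>n. prob (E n)) sums prob (\<Union>n. E n)"
  proof (rule finite_measure_UNION)
    show "disjoint_family E"
    proof (unfold disjoint_family_on_def, intro ballI impI)
      fix m n :: nat
      assume "m \<noteq> n"
      then consider "m < n" | "n < m" by linarith
      then show "E m \<inter> E n = {}" by cases (auto simp: E_def)
    qed
  qed (use E in auto)
  have return: "(\<Union>n. E n) = {\<omega>\<in>space M. \<exists>n\<ge>1. S n \<omega> = 0}"
  proof (intro equalityI subsetI)
    fix \<omega> assume \<omega>: "\<omega> \<in> {\<omega>\<in>space M. \<exists>n\<ge>1. S n \<omega> = 0}"
    define n where "n = (LEAST n. 0 < n \<and> S n \<omega> = 0)"
    obtain r where r: "0 < r \<and> S r \<omega> = 0" using \<omega> by (auto simp: Suc_le_eq)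
    have "0 < n \<and> S n \<omega> = 0" unfolding n_def by (rule LeastI) (rule r)
    moreover have "S m \<omega> \<noteq> 0" if "0 < m" "m < n" for m
      using that not_less_Least[of m] unfolding n_def by blast
    ultimately show "\<omega> \<in> (\<Union>n. E n)" using \<omega> by (auto simp: E_def)
  qed (auto simp: E_def Suc_le_eq)
  have prob_E: "prob (E n) = card (first_loops n :: (int ^ 'd) list set) / (2 * real CARD('d)) ^ n" for n
  proof -
    let ?D = "\<lambda>\<omega>. map (\<lambda>i. S (Suc i) \<omega> - S i \<omega>) [0..<n]"
    have iff: "\<omega> \<in> E n \<longleftrightarrow> ?D \<omega> \<in> first_loops n" if \<omega>: "\<omega> \<in> space M" and D: "?D \<omega> \<in> walks n" for \<omega>
    proof -
      have "sum_list (take m (?D \<omega>)) = S m \<omega>" if "m \<le> n" for m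
        using that walk_eq_sum_increments[OF walk \<omega>, of m] by (simp add: take_map)
      moreover from this[of n] have "sum_list (?D \<omega>) = S n \<omega>" by simp
      ultimately show ?thesis
        using \<omega> D by (auto simp: E_def first_loops_def loops_def)
    qed
    have walks: "(first_loops n :: (int ^ 'd) list set) \<subseteq> walks n"
      using first_loops_subset loops_subset by blast
    note D = increments_in_events[OF walk walks]
    have "prob (E n) = prob {\<omega>\<in>space M. ?D \<omega> \<in> first_loops n}"
      by (rule measure_eq_AE[OF _ E D]) (use AE_increments[OF walk, of n] iff in auto)
    also have "\<dots> = card (first_loops n :: (int ^ 'd) list set) / (2 * real CARD('d)) ^ n"
      by (rule prob_increments_in[OF walk walks])
    finally show ?thesis .
  qed
  show ?thesis
    using sums unfolding return prob_E return_probability_def .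
qed

section \<open>The return probability\<close>

theorem mainTheorem2:
  fixes M :: "'a measure" and S :: "nat \<Rightarrow> 'a \<Rightarrow> int ^ 'd"
  assumes "CARD('d) \<ge> 3"
    and "simple_random_walk M S"
  shows "lauricella_FC_term (1::real) (1/2) (\<chi> i::'d. 1) (\<chi> i. 1 / (real CARD('d))\<^sup>2)
           summable_on UNIV \<and>
         return_probability M S =
           1 - inverse (lauricella_FC (1::real) (1/2) (\<chi> i::'d. 1) (\<chi> i. 1 / (real CARD('d))\<^sup>2))"
proof -
  define u where "u n = card (loops n :: (int ^ 'd) list set) / (2 * real CARD('d)) ^ n" for n
  define f where "f n = card (first_loops n :: (int ^ 'd) list set) / (2 * real CARD('d)) ^ n" for n
  define G where "G = infsum (loop_weight :: nat ^ 'd \<Rightarrow> real) UNIV"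
  define p where "p = return_probability M S"
  have u: "u sums G" unfolding u_def G_def by (rule loop_series_sums[OF assms(1)])
  have f: "f sums p" unfolding f_def p_def by (rule return_probability_sums[OF assms(2)])
  \<comment> \<open>The correction at \<open>n = 0\<close>: there the convolution vanishes, whereas \<open>u 0 = 1\<close>.\<close>
  have renewal: "(\<Sum>k\<le>n. f k * u (n - k)) = u n - (if n = 0 then 1 else 0)" for n
  proof (cases "n = 0")
    case True
    then show ?thesis by (simp add: f_def u_def loops_0 first_loops_def)
  next
    case False
    have "f k * u (n - k) = real (card (first_loops k :: (int ^ 'd) list set) *
        card (loops (n - k) :: (int ^ 'd) list set)) / (2 * real CARD('d)) ^ n" if "k \<le> n" for k
    proof -
      have "(2 * real CARD('d)) ^ n = (2 * real CARD('d)) ^ k * (2 * real CARD('d)) ^ (n - k)"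
        using that by (subst power_add[symmetric]) simp
      then show ?thesis
        by (simp only: f_def u_def times_divide_times_eq of_nat_mult)
    qed
    then show ?thesis
      using False card_loops_renewal[of n, where 'd = 'd] by (simp add: u_def flip: sum_divide_distrib)
  qed
  have "(\<lambda>n. \<Sum>k\<le>n. f k * u (n - k)) sums (suminf f * suminf u)"
  proof (rule Cauchy_product_sums)
    have "norm (f k) = f k" "norm (u k) = u k" for k by (simp_all add: f_def u_def)
    then show "summable (\<lambda>k. norm (f k))" "summable (\<lambda>k. norm (u k))"
      using f u by (simp_all add: sums_iff)
  qed
  then have "(\<lambda>n. u n - (if n = 0 then 1 else 0)) sums (p * G)"
    using u f by (simp add: renewal sums_iff)
  moreover have "(\<lambda>n. u n - (if n = 0 then 1 else 0)) sums (G - 1)"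
    using sums_diff[OF u sums_single[of 0 "\<lambda>_. 1"]] by simp
  ultimately have eq: "p * G = G - 1" by (rule sums_unique2)
  then have "G \<noteq> 0" by auto
  with eq have "p = 1 - inverse G" by (simp add: field_simps)
  moreover have "lauricella_FC_term (1::real) (1/2) (\<chi> i::'d. 1) (\<chi> i. 1 / (real CARD('d))\<^sup>2) = loop_weight"
    by (rule ext) (rule lauricella_FC_term_eq_loop_weight)
  ultimately show ?thesis
    using loop_weight_summable[OF assms(1)] by (simp add: lauricella_FC_def G_def p_def)
qed

end
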